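(* The algorithm $\mathrm{SortedF}$ has a constant approximation ratio strictly below $48$: $\mathrm{AR}(\mathrm{SortedF})<48$. Explicitly, for every family of instances $(\mathcal I_M)_M$ indexed by the memory capacity $M$, where $\mathcal I_M$ consists of $n(M)$ requests $(s_i,o_i)$ and, with $L(M):=\max_{i\in[n(M)]}\{s_i+o_i\}$, one has $L(M)/M\to 0$ and $n(M)L(M)/M\to\infty$ as $M\to\infty$, there is an $M_0$ such that $$\sup_{M\ge M_0}\ \frac{\mathrm{TEL}(\mathrm{SortedF};\mathcal I_M)}{\mathrm{TEL}(\mathrm{Optimal};\mathcal I_M)}<48 ,$$ where $\mathrm{Optimal}$ denotes a feasible schedule of minimum total end-to-end latency for $\mathcal I_M$ with capacity $M$.
   Context: Model. A single worker has memory capacity $M$ (a positive integer). An instance $\mathcal I$ is a finite set of $n$ requests, all available at time $0$; request $r_i$ has a prefill size $s_i$ and an output length $o_i$, both positive integers. Time is discrete. A schedule $\Lambda$ assigns to each request an integer start time $p_i\ge 0$. Request $r_i$ then runs without interruption, generating its $j$-th output token ($j=1,\dots,o_i$) at time $p_i+j$ and using $s_i+j$ units of memory at that time, and it completes, releasing its memory, at time $c_i(\Lambda)=p_i+o_i$. The schedule is feasible if at every time $t\ge 1$, $\sum_{i:\,1\le t-p_i\le o_i}(s_i+t-p_i)\le M$. The total end-to-end latency is $\mathrm{TEL}(\Lambda;\mathcal I)=\sum_i c_i(\Lambda)$. The approximation ratio of an algorithm is the supremum over instances of the ratio of its TEL to the optimal TEL. For a nonempty set $\mathcal X$ of requests let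 $F(\mathcal X)=\big(\sum_{r_i\in\mathcal X}o_i\big)/|\mathcal X|^2$. For a set $\mathcal X$ of requests with assigned start times $p_i$ and a time $t^*$ let $M(\mathcal X,t^* )=\sum_{r_i\in\mathcal X,\ o_i\ge t^*-p_i}(s_i+t^*-p_i)$. Algorithm $\mathrm{SortedF}$. Phase 1 (batch construction): start with the set of all requests and an empty ordered list $\mathcal I'$. While requests remain, among all nonempty subsets $\mathcal X$ of the remaining requests that are feasible when all started simultaneously at time $0$ (i.e. $M(\mathcal X,o_j)\le M$ for all $r_j\in\mathcal X$ with all $p_i=0$), choose $\mathcal X^*$ minimizing $(F(\mathcal X),-|\mathcal X|)$ lexicographically (minimal $F$, ties broken in favour of larger cardinality; remaining ties arbitrary). Sort $\mathcal X^*$ in nondecreasing order of $o_i$, append it to the end of $\mathcal I'$, and remove $\mathcal X^*$ from the remaining requests. Phase 2 (execution): at each time $t=0,1,2,\dots$ until all requests have completed, let $\mathcal V$ be the set of requests started before $t$ with $p_j+o_j>t$. Scan the not-yet-started requests in the order of $\mathcal I'$; tentatively set $p_i=t$ for the next request $r_i$ and admit it (starting at time $t$) if, with $\mathcal W$ the set consisting of $\mathcal V$, the requests already admitted at time $t$, and $r_i$, one has $M(\mathcal W,p_j+o_j)\le M$ for all $r_j\in\mathcal W$; stop the scan at time $t$ at the first request that is not admissible. *)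

theory Defs
  imports Complex_Main "HOL-Library.Extended_Real"
begin

text \<open>
  An instance is the list of the pairs (prefill size, output length) of its requests; requests
  are referred to by their position, so that distinct requests may have equal parameters.
\<close>

type_synonym requests = "(nat \<times> nat) list"
type_synonym schedule = "nat \<Rightarrow> nat"

abbreviation prefill :: "requests \<Rightarrow> nat \<Rightarrow> nat" where
  "prefill I i \<equiv> fst (I ! i)"

abbreviation outlen :: "requests \<Rightarrow> nat \<Rightarrow> nat" where
  "outlen I i \<equiv> snd (I ! i)"

definition valid_instance :: "requests \<Rightarrow> bool" where
  "valid_instance I \<longleftrightarrow> (\<forall>i < length I. prefill I i > 0 \<and> outlen I i > 0)"

definition max_size :: "requests \<Rightarrow> nat" where
  "max_size I = Max {prefill I i + outlen I i | i. i < length I}"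

definition feasible :: "nat \<Rightarrow> requests \<Rightarrow> schedule \<Rightarrow> bool" where
  "feasible M I p \<longleftrightarrow>
     (\<forall>t\<ge>1. (\<Sum>i | i < length I \<and> p i + 1 \<le> t \<and> t \<le> p i + outlen I i.
               prefill I i + (t - p i)) \<le> M)"

definition TEL :: "requests \<Rightarrow> schedule \<Rightarrow> nat" where
  "TEL I p = (\<Sum>i < length I. p i + outlen I i)"

definition TEL_opt :: "nat \<Rightarrow> requests \<Rightarrow> nat" where
  "TEL_opt M I = (LEAST c. \<exists>p. feasible M I p \<and> TEL I p = c)"

definition F_val :: "requests \<Rightarrow> nat set \<Rightarrow> real" where
  "F_val I X = (\<Sum>i\<in>X. real (outlen I i)) / (real (card X))\<^sup>2"

text \<open>
  Only evaluated at times \<open>t\<close> with \<open>p i \<le> t\<close> for all \<open>i \<in> X\<close>, so the subtraction is exact.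
\<close>

definition mem_at :: "requests \<Rightarrow> schedule \<Rightarrow> nat set \<Rightarrow> nat \<Rightarrow> nat" where
  "mem_at I p X t = (\<Sum>i | i \<in> X \<and> t - p i \<le> outlen I i. prefill I i + (t - p i))"

definition batch_candidate :: "nat \<Rightarrow> requests \<Rightarrow> nat set \<Rightarrow> nat set \<Rightarrow> bool" where
  "batch_candidate M I R X \<longleftrightarrow>
     X \<subseteq> R \<and> X \<noteq> {} \<and> (\<forall>j\<in>X. mem_at I (\<lambda>_. 0) X (outlen I j) \<le> M)"

definition best_batch :: "nat \<Rightarrow> requests \<Rightarrow> nat set \<Rightarrow> nat set \<Rightarrow> bool" where
  "best_batch M I R X \<longleftrightarrow>
     batch_candidate M I R X \<and>
     (\<forall>Y. batch_candidate M I R Y \<longrightarrow>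
        F_val I X < F_val I Y \<or> F_val I X = F_val I Y \<and> card Y \<le> card X)"

text \<open>
  \<open>batch_order M I R ord\<close>: the batch construction started with remaining requests \<open>R\<close> can
  produce the order \<open>ord\<close>. It is a relation because ties, in the choice of a batch and in
  sorting it by output length, are broken arbitrarily.
\<close>

inductive batch_order :: "nat \<Rightarrow> requests \<Rightarrow> nat set \<Rightarrow> nat list \<Rightarrow> bool"
  for M :: nat and I :: requests where
  empty: "batch_order M I {} []"
| batch: "\<lbrakk> best_batch M I R X; set xs = X; distinct xs; sorted (map (outlen I) xs);
            batch_order M I (R - X) ys \<rbrakk> \<Longrightarrow> batch_order M I R (xs @ ys)"

text \<open>
  The scan at time \<open>t\<close>: \<open>A\<close> consists of the running requests and those already admitted at
  time \<open>t\<close>. The result is the updated start times and the requests still waiting.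
\<close>

fun admit :: "nat \<Rightarrow> requests \<Rightarrow> nat \<Rightarrow> nat set \<Rightarrow> schedule \<Rightarrow> nat list \<Rightarrow> schedule \<times> nat list" where
  "admit M I t A p [] = (p, [])"
| "admit M I t A p (i # ws) =
     (let p' = p(i := t); W = insert i A in
      if \<forall>j\<in>W. mem_at I p' W (p' j + outlen I j) \<le> M
      then admit M I t W p' ws
      else (p, i # ws))"

text \<open>
  \<open>exec M I ord t\<close> is the state just before the scan at time \<open>t\<close>; start times of waiting
  requests are meaningless.
\<close>

primrec exec :: "nat \<Rightarrow> requests \<Rightarrow> nat list \<Rightarrow> nat \<Rightarrow> schedule \<times> nat list" where
  "exec M I ord 0 = ((\<lambda>_. 0), ord)"
| "exec M I ord (Suc t) =
     (let (p, ws) = exec M I ord t;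
          V = {j \<in> set ord - set ws. p j + outlen I j > t}
      in admit M I t V p ws)"

text \<open>The schedules that the algorithm can output, over all ways of breaking ties.\<close>

definition SortedF :: "nat \<Rightarrow> requests \<Rightarrow> schedule set" where
  "SortedF M I =
     {p. \<exists>ord t. batch_order M I {..<length I} ord \<and> exec M I ord t = (p, [])}"

text \<open>
  The rest of the theory shows that if every request fits into memory on its own, then the
  algorithm terminates with a schedule (\<open>SortedF_nonempty\<close>), every such schedule is
  feasible (\<open>SortedF_feasible\<close>), and \<open>TEL_opt\<close> is attained (\<open>TEL_opt_attained\<close>).
  Otherwise \<open>TEL_opt\<close> is unspecified.
\<close>

lemma best_batch_exists:
  assumes "R \<subseteq> {..<length I}" "R \<noteq> {}"
    and fit: "\<And>i. i < length I \<Longrightarrow> prefill I i + outlen I i \<le> M"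
  shows "\<exists>X. best_batch M I R X"
proof -
  define C where "C = {X. batch_candidate M I R X}"
  have finR: "finite R" using assms(1) finite_subset by blast
  have fin: "finite C"
    unfolding C_def by (rule finite_subset[of _ "Pow R"]) (auto simp: batch_candidate_def finR)
  obtain i where i: "i \<in> R" using assms(2) by auto
  have "{x. x = i \<and> outlen I i \<le> outlen I x} = {i}" by auto
  then have "mem_at I (\<lambda>_. 0) {i} (outlen I i) = prefill I i + outlen I i"
    by (simp add: mem_at_def)
  then have "{i} \<in> C"
    using i fit assms(1) by (auto simp: C_def batch_candidate_def)
  then have ne: "C \<noteq> {}" by auto
  define m where "m = Min (F_val I ` C)"
  define D where "D = {X \<in> C. F_val I X = m}"
  have "m \<in> F_val I ` C" unfolding m_def by (rule Min_in) (use fin ne in auto)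
  then have "D \<noteq> {}" "finite D" using fin by (auto simp: D_def)
  then have "Max (card ` D) \<in> card ` D" by (intro Max_in) auto
  then obtain X where X: "X \<in> D" "card X = Max (card ` D)" by auto
  have "F_val I X < F_val I Y \<or> F_val I X = F_val I Y \<and> card Y \<le> card X" if "Y \<in> C" for Y
  proof -
    have "m \<le> F_val I Y" unfolding m_def using that fin by auto
    moreover have "card Y \<le> card X" if "F_val I Y = m"
      using that \<open>Y \<in> C\<close> \<open>finite D\<close> X(2) by (auto simp: D_def)
    ultimately show ?thesis using X(1) by (auto simp: D_def)
  qed
  then show ?thesis using X(1) by (auto simp: best_batch_def C_def D_def)
qed

lemma batch_order_exists:
  assumes "R \<subseteq> {..<length I}"
    and fit: "\<And>i. i < length I \<Longrightarrow> prefill I i + outlen I i \<le> M"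
  shows "\<exists>ord. batch_order M I R ord"
  using assms(1)
proof (induction "card R" arbitrary: R rule: less_induct)
  case less
  show ?case
  proof (cases "R = {}")
    case True
    then show ?thesis using batch_order.empty by blast
  next
    case False
    then obtain X where X: "best_batch M I R X" using best_batch_exists less fit by blast
    then have sub: "X \<subseteq> R" "X \<noteq> {}" by (auto simp: best_batch_def batch_candidate_def)
    have fin: "finite R" using less.prems finite_subset by blast
    with sub have "R - X \<subset> R" by auto
    with fin have "card (R - X) < card R" by (rule psubset_card_mono)
    then obtain ys where ys: "batch_order M I (R - X) ys" using less by blast
    define xs where "xs = sort_key (outlen I) (sorted_list_of_set X)"
    have finX: "finite X" using fin sub finite_subset by blast
    have "set xs = X" "distinct xs" "sorted (map (outlen I) xs)"
      using finX by (simp_all add: xs_def)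
    then show ?thesis using batch_order.batch[OF X _ _ _ ys] by blast
  qed
qed

declare admit.simps(2) [simp del]

lemma batch_order_props:
  assumes "batch_order M I R ord"
  shows "set ord = R \<and> distinct ord"
  using assms by induction (auto simp: best_batch_def batch_candidate_def)

lemma admit_yes:
  "\<forall>j\<in>insert i A. mem_at I (p(i := t)) (insert i A) ((p(i := t)) j + outlen I j) \<le> M
   \<Longrightarrow> admit M I t A p (i # ws) = admit M I t (insert i A) (p(i := t)) ws"
  unfolding admit.simps Let_def by (rule if_P)

lemma admit_no:
  "\<not> (\<forall>j\<in>insert i A. mem_at I (p(i := t)) (insert i A) ((p(i := t)) j + outlen I j) \<le> M)
   \<Longrightarrow> admit M I t A p (i # ws) = (p, i # ws)"
  unfolding admit.simps Let_def by (rule if_not_P)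

lemma admit_length:
  "length (snd (admit M I t A p ws)) \<le> length ws \<and>
   (length (snd (admit M I t A p ws)) = length ws \<longrightarrow> admit M I t A p ws = (p, ws))"
proof (induction M I t A p ws rule: admit.induct)
  case (1 M I t A p)
  show ?case by simp
next
  case (2 M I t A p i ws)
  let ?p = "p(i := t)" and ?W = "insert i A"
  show ?case
  proof (cases "\<forall>j\<in>?W. mem_at I ?p ?W (?p j + outlen I j) \<le> M")
    case True
    then have "admit M I t A p (i # ws) = admit M I t ?W ?p ws" by (rule admit_yes)
    moreover have "length (snd (admit M I t ?W ?p ws)) \<le> length ws" using 2[OF refl refl True] by blast
    ultimately show ?thesis by simp
  next
    case False
    then have "admit M I t A p (i # ws) = (p, i # ws)" by (rule admit_no)
    then show ?thesis by simp
  qed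
qed

lemma admit_started:
  assumes "admit M I t A p ws = (p', ws')" "distinct ws"
  shows "set ws' \<subseteq> set ws \<and> distinct ws' \<and> (\<forall>j. j \<notin> set ws \<longrightarrow> p' j = p j) \<and> (\<forall>j\<in>set ws - set ws'. p' j = t)"
  using assms
proof (induction M I t A p ws arbitrary: p' ws' rule: admit.induct)
  case (1 M I t A p)
  then show ?case by simp
next
  case (2 M I t A p i ws)
  let ?p = "p(i := t)" and ?W = "insert i A"
  show ?case
  proof (cases "\<forall>j\<in>?W. mem_at I ?p ?W (?p j + outlen I j) \<le> M")
    case True
    have a: "admit M I t ?W ?p ws = (p', ws')"
      using "2.prems"(1) unfolding admit_yes[OF True] .
    show ?thesis using "2.IH"[OF refl refl True a] "2.prems"(2) by auto
  next
    case False
    have "p' = p" "ws' = i # ws"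
      using "2.prems"(1) unfolding admit_no[OF False] by simp_all
    then show ?thesis using "2.prems"(2) by simp
  qed
qed

lemma exec_started:
  assumes "distinct ord" "exec M I ord t = (p, ws)"
  shows "set ws \<subseteq> set ord \<and> distinct ws \<and> (\<forall>j\<in>set ord - set ws. p j < t)"
  using assms(2)
proof (induction t arbitrary: p ws)
  case 0
  then show ?case using assms(1) by auto
next
  case (Suc t)
  obtain p0 ws0 where e: "exec M I ord t = (p0, ws0)" by fastforce
  with Suc.prems have a: "admit M I t {j \<in> set ord - set ws0. p0 j + outlen I j > t} p0 ws0 = (p, ws)"
    by simp
  note i = Suc.IH[OF e]
  have s: "set ws \<subseteq> set ws0" "distinct ws" "\<And>j. j \<notin> set ws0 \<Longrightarrow> p j = p0 j"
    "\<And>j. j \<in> set ws0 \<Longrightarrow> j \<notin> set ws \<Longrightarrow> p j = t"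
    using admit_started[OF a] i by auto
  have "p j < Suc t" if "j \<in> set ord" "j \<notin> set ws" for j
  proof (cases "j \<in> set ws0")
    case True
    then show ?thesis using s(4)[of j] that by simp
  next
    case False
    then have "p0 j < t" using i that(1) by blast
    then show ?thesis using s(3)[OF False] by simp
  qed
  then show ?case using s i by blast
qed

lemma exec_finishes:
  assumes "distinct ord" "set ord \<subseteq> {..<length I}"
    and fit: "\<And>i. i < length I \<Longrightarrow> prefill I i + outlen I i \<le> M"
  shows "\<exists>t. snd (exec M I ord t) = []"
proof -
  have *: "\<exists>t. length (snd (exec M I ord t)) < k" if "length (snd (exec M I ord t0)) = k" "k > 0" for t0 k
  proof (rule ccontr)
    assume "\<not> ?thesis"
    then have ge: "length (snd (exec M I ord t)) \<ge> k" for t by (meson not_less)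
    obtain p ws where e0: "exec M I ord t0 = (p, ws)" by fastforce
    have e: "exec M I ord (t0 + d) = (p, ws)" for d
    proof (induction d)
      case 0
      then show ?case using e0 by simp
    next
      case (Suc d)
      let ?a = "admit M I (t0 + d) {j \<in> set ord - set ws. p j + outlen I j > t0 + d} p ws"
      have s: "exec M I ord (t0 + Suc d) = ?a" using Suc by simp
      then have "length (snd ?a) \<ge> length ws" using ge[of "t0 + Suc d"] that(1) e0 by simp
      then have "?a = (p, ws)" using admit_length le_antisym by blast
      then show ?case using s by simp
    qed
    have pl: "\<forall>j\<in>set ord - set ws. p j < t0" and sub: "set ws \<subseteq> set ord"
      using exec_started[OF assms(1) e0] by auto
    have "outlen I j \<le> M" if "j \<in> set ord" for j
      using fit[of j] that assms(2) by auto
    then have V: "{j \<in> set ord - set ws. p j + outlen I j > t0 + M} = {}"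
      using pl by (auto simp: not_less) (meson DiffI add_mono less_imp_le)
    have "ws \<noteq> []" using that e0 by auto
    then obtain i us where ws: "ws = i # us" by (cases ws) auto
    let ?T = "t0 + M"
    have "{x \<in> {i}. ?T + outlen I i - (p(i := ?T)) x \<le> outlen I x} = {i}" by auto
    then have "mem_at I (p(i := ?T)) {i} (?T + outlen I i) = prefill I i + outlen I i"
      unfolding mem_at_def by (simp only: sum.insert finite.emptyI) simp
    also have "\<dots> \<le> M" using fit ws sub assms(2) by auto
    finally have single: "mem_at I (p(i := ?T)) {i} (?T + outlen I i) \<le> M" .
    have "admit M I (t0 + M) {} p ws = admit M I (t0 + M) {i} (p(i := t0 + M)) us"
      unfolding ws by (rule admit_yes) (use single in simp)
    moreover have "length (snd (admit M I (t0 + M) {i} (p(i := t0 + M)) us)) \<le> length us"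
      using admit_length by blast
    moreover have "exec M I ord (Suc (t0 + M)) = admit M I (t0 + M) {} p ws"
      by (simp only: exec.simps e[of M] Let_def prod.case V)
    ultimately show False using ge[of "Suc (t0 + M)"] that e0 ws by simp
  qed
  define k where "k = (LEAST k. \<exists>t. length (snd (exec M I ord t)) = k)"
  have "\<exists>t. length (snd (exec M I ord t)) = k" unfolding k_def by (rule LeastI_ex) blast
  then obtain t0 where t0: "length (snd (exec M I ord t0)) = k" by blast
  have "k = 0"
  proof (rule ccontr)
    assume "k \<noteq> 0"
    then obtain t where "length (snd (exec M I ord t)) < k" using *[OF t0] by auto
    then show False using not_less_Least unfolding k_def by blast
  qed
  then show ?thesis using t0 by auto
qed

lemma SortedF_nonempty:
  assumes "\<And>i. i < length I \<Longrightarrow> prefill I i + outlen I i \<le> M"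
  shows "SortedF M I \<noteq> {}"
proof -
  obtain ord where o: "batch_order M I {..<length I} ord"
    using batch_order_exists[of "{..<length I}" I M] assms by blast
  obtain t where "snd (exec M I ord t) = []"
    using exec_finishes[of ord I M] batch_order_props[OF o] assms by blast
  then have "exec M I ord t = (fst (exec M I ord t), [])" by (metis prod.collapse)
  then show ?thesis using o by (auto simp: SortedF_def)
qed

definition usage :: "requests \<Rightarrow> schedule \<Rightarrow> nat set \<Rightarrow> nat \<Rightarrow> nat" where
  "usage I p S t = (\<Sum>i | i \<in> S \<and> p i + 1 \<le> t \<and> t \<le> p i + outlen I i. prefill I i + (t - p i))"

lemma usage_le_of_checks:
  assumes "finite W" "\<And>j. j \<in> W \<Longrightarrow> p j \<le> t" "t < \<tau>"
    and chk: "\<And>j. j \<in> W \<Longrightarrow> p j + outlen I j > t \<Longrightarrow> mem_at I p {j \<in> W. p j + outlen I j > t} (p j + outlen I j) \<le> M"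
  shows "usage I p W \<tau> \<le> M"
proof -
  let ?U = "{i. i \<in> W \<and> p i + 1 \<le> \<tau> \<and> \<tau> \<le> p i + outlen I i}"
  show ?thesis
  proof (cases "?U = {}")
    case True
    show ?thesis unfolding usage_def True by simp
  next
    case False
    have fin: "finite ?U" using assms(1) by auto
    define c where "c = Min ((\<lambda>i. p i + outlen I i) ` ?U)"
    have "c \<in> (\<lambda>i. p i + outlen I i) ` ?U" unfolding c_def by (rule Min_in) (use fin False in auto)
    then obtain j where j: "j \<in> ?U" "c = p j + outlen I j" by auto
    have cle: "c \<le> p i + outlen I i" if "i \<in> ?U" for i
      unfolding c_def by (rule Min_le) (use that fin in auto)
    have tc: "\<tau> \<le> c" using j by simp
    have "usage I p W \<tau> \<le> mem_at I p {j \<in> W. p j + outlen I j > t} c"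
      unfolding usage_def mem_at_def
    proof (rule order.trans[OF sum_mono sum_mono2])
      fix i assume "i \<in> ?U"
      show "prefill I i + (\<tau> - p i) \<le> prefill I i + (c - p i)" using tc by auto
    next
      show "finite {i \<in> {j \<in> W. t < p j + outlen I j}. c - p i \<le> outlen I i}" using assms(1) by auto
      show "?U \<subseteq> {i \<in> {j \<in> W. t < p j + outlen I j}. c - p i \<le> outlen I i}"
        using cle assms(3) by fastforce
    qed auto
    also have "\<dots> \<le> M" using chk[of j] j assms(3) by auto
    finally show ?thesis .
  qed
qed

lemma admit_usage:
  assumes "admit M I t A p ws = (p', ws')" "distinct ws" "S \<inter> set ws = {}" "finite S"
    and pos: "\<And>j. j \<in> set ws \<Longrightarrow> outlen I j > 0"
    and "\<And>j. j \<in> S \<Longrightarrow> p j \<le> t" "A = {j\<in>S. p j + outlen I j > t}"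
    and "\<And>\<tau>. usage I p S \<tau> \<le> M"
  shows "usage I p' (S \<union> (set ws - set ws')) \<tau> \<le> M"
  using assms
proof (induction M I t A p ws arbitrary: S p' ws' rule: admit.induct)
  case (1 M I t A p)
  then show ?case by simp
next
  case (2 M I t A p i ws)
  let ?p = "p(i := t)" and ?W = "insert i A"
  show ?case
  proof (cases "\<forall>j\<in>?W. mem_at I ?p ?W (?p j + outlen I j) \<le> M")
    case False
    have "p' = p" "ws' = i # ws"
      using "2.prems"(1) unfolding admit_no[OF False] by simp_all
    then show ?thesis using "2.prems" by simp
  next
    case True
    let ?S = "insert i S"
    have iS: "i \<notin> S" using "2.prems"(3) by auto
    have a: "admit M I t ?W ?p ws = (p', ws')" using "2.prems"(1) unfolding admit_yes[OF True] .
    have W: "?W = {j \<in> ?S. ?p j + outlen I j > t}"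
      using "2.prems"(5)[of i] "2.prems"(7) iS by auto
    have le: "?p j \<le> t" if "j \<in> ?S" for j using that "2.prems"(6) by auto
    have us: "usage I ?p ?S \<tau> \<le> M" for \<tau>
    proof (cases "t < \<tau>")
      case True
      then show ?thesis
        by (rule usage_le_of_checks[rotated 2])
           (use "2.prems"(4) le W \<open>\<forall>j\<in>?W. _ j\<close> in \<open>auto simp del: fun_upd_apply\<close>)
    next
      case False
      have "usage I ?p ?S \<tau> = usage I p S \<tau>"
        unfolding usage_def by (rule sum.cong) (use False iS in auto)
      then show ?thesis using "2.prems"(8) by simp
    qed
    have "set ws' \<subseteq> set ws" using admit_started[OF a] "2.prems"(2) by auto
    then have eq: "S \<union> (set (i # ws) - set ws') = ?S \<union> (set ws - set ws')"
      using "2.prems"(2) by auto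
    show ?thesis unfolding eq
      by (rule "2.IH"[OF refl refl True a])
         (use "2.prems" le W us in \<open>auto simp del: fun_upd_apply\<close>)
  qed
qed

lemma exec_usage:
  assumes "distinct ord" "\<And>j. j \<in> set ord \<Longrightarrow> outlen I j > 0" "exec M I ord t = (p, ws)"
  shows "usage I p (set ord - set ws) \<tau> \<le> M"
  using assms(3)
proof (induction t arbitrary: p ws \<tau>)
  case 0
  then show ?case by (auto simp: usage_def)
next
  case (Suc t)
  obtain p0 ws0 where e: "exec M I ord t = (p0, ws0)" by fastforce
  let ?S = "set ord - set ws0"
  have a: "admit M I t {j \<in> ?S. p0 j + outlen I j > t} p0 ws0 = (p, ws)"
    using e Suc.prems by simp
  note s = exec_started[OF assms(1) e]
  have "usage I p (?S \<union> (set ws0 - set ws)) \<tau> \<le> M"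
    by (rule admit_usage[OF a]) (use s assms(2) Suc.IH[OF e] in \<open>auto intro: less_imp_le\<close>)
  moreover have "?S \<union> (set ws0 - set ws) = set ord - set ws"
    using s admit_started[OF a] by auto
  ultimately show ?case by simp
qed

lemma SortedF_feasible:
  assumes "valid_instance I" "p \<in> SortedF M I"
  shows "feasible M I p"
proof -
  obtain ord t where o: "batch_order M I {..<length I} ord" and e: "exec M I ord t = (p, [])"
    using assms(2) by (auto simp: SortedF_def)
  note b = batch_order_props[OF o]
  have "usage I p {..<length I} \<tau> \<le> M" for \<tau>
    using exec_usage[of ord I M t p "[]" \<tau>] b e assms(1) by (auto simp: valid_instance_def)
  then show ?thesis by (simp add: feasible_def usage_def)
qed

lemma TEL_opt_attained:
  assumes "\<And>i. i < length I \<Longrightarrow> prefill I i + outlen I i \<le> M" "valid_instance I"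
  shows "\<exists>p. feasible M I p \<and> TEL I p = TEL_opt M I"
proof -
  have "\<exists>p. feasible M I p" using SortedF_nonempty[of I M] SortedF_feasible assms by blast
  then show ?thesis unfolding TEL_opt_def by (rule_tac LeastI_ex) blast
qed

end

theory Submission imports Defs begin

text \<open>
  The bound proved here is \<open>TEL \<le> 36 * TEL_opt\<close> whenever no request occupies more than a fifth of
  the memory; the limit \<open>L(M)/M \<rightarrow> 0\<close> provides this for all large \<open>M\<close>.  The argument
  has the shape of the analysis of the greedy algorithm for min-sum set cover.

  \<^bold>\<open>The algorithm is no slower than running its batches one after the other.\<close>  Inside a batch the
  requests are sorted by output length and are started in this order.  If some of them
  start earlier than the rest, then at every later moment the first alive request in this order is
  both the shortest and the longest running one, so each alive request occupies at most what it
  would occupy in a simultaneous run of the batch at the moment at which the first one finishes.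
  Hence an early start never spoils the admission of the rest of the batch
  (\<open>admit_rest_of_batch\<close>), and batch \<open>k\<close> has started by the
  time \<open>T\<^sub>1 + \<dots> + T\<^sub>k\<^sub>-\<^sub>1\<close>, where \<open>T\<^sub>l\<close> is the maximal output length in batch \<open>l\<close>.  Minimality of \<open>F\<close>
  gives \<open>T\<^sub>l \<le> 2 * n\<^sub>l * F\<^sub>l\<close>, with \<open>n\<^sub>l\<close> the size of the batch, since otherwise
  dropping its longest request would decrease \<open>F\<close>.  With \<open>R\<^sub>k\<close> the number of requests
  remaining when batch \<open>k\<close> is formed, the total latency is therefore at most
  \<open>\<Sum>\<^sub>k T\<^sub>k * R\<^sub>k \<le> 2 * (\<Sum>\<^sub>k n\<^sub>k * (F\<^sub>k * R\<^sub>k))\<close>: twice the total price, if each request of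
  batch \<open>k\<close> is charged the price \<open>F\<^sub>k * R\<^sub>k\<close>.

  \<^bold>\<open>No schedule finishes requests much faster than the current value of F allows.\<close>  If all feasible
  batches from a set have \<open>F\<close> at least \<open>f\<close>, then any feasible schedule completes at most \<open>9/2 * t / f\<close>
  requests of the set by time \<open>t\<close> (\<open>completions_bound\<close>).  To see this, cut the completed requests,
  by increasing output length, into consecutive groups that fill the memory up to a remainder of
  a fifth.  A group of size \<open>n\<close> has average output length at least \<open>f * n\<close>, so the
  requests in the next group are at least that long, and this next group has a volume (memory
  integrated over time) of order at least \<open>f * n * M\<close>.  The total volume is at most \<open>M * t\<close>.

  \<^bold>\<open>Comparing histograms.\<close>  By the previous bound at least half of the \<open>R\<^sub>k\<close> requests that remain at
  batch \<open>k\<close> complete after time \<open>F\<^sub>k * R\<^sub>k / 9\<close> in the optimal schedule.  So, for every \<open>z\<close>, there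
  are at most twice as many requests of price above \<open>9 * z\<close> as requests that the optimal schedule
  completes after \<open>z\<close>.  Summation over \<open>z\<close> bounds the total price by \<open>18\<close> times the optimum.
\<close>

section \<open>Execution of the batches\<close>

lemma admit_prefix:
  assumes "admit M I t A p ws = (p', ws')"
  shows "\<exists>us. ws = us @ ws'"
  using assms
proof (induction M I t A p ws arbitrary: p' ws' rule: admit.induct)
  case (1 M I t A p)
  then show ?case by simp
next
  case (2 M I t A p i ws)
  let ?p = "p(i := t)" and ?W = "insert i A"
  show ?case
  proof (cases "\<forall>j\<in>?W. mem_at I ?p ?W (?p j + outlen I j) \<le> M")
    case True
    have "admit M I t ?W ?p ws = (p', ws')" using "2.prems" unfolding admit_yes[OF True] .
    from "2.IH"[OF refl refl True this] show ?thesis by (metis append_Cons)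
  next
    case False
    then show ?thesis using "2.prems" unfolding admit_no[OF False] by auto
  qed
qed

lemma exec_prefix_sorted:
  assumes "distinct ord" "exec M I ord t = (p, ws)"
  shows "\<exists>pre. ord = pre @ ws \<and> sorted (map p pre)"
  using assms(2)
proof (induction t arbitrary: p ws)
  case 0
  then show ?case by auto
next
  case (Suc t)
  obtain p0 ws0 where e: "exec M I ord t = (p0, ws0)" by fastforce
  with Suc.prems have a: "admit M I t {j \<in> set ord - set ws0. p0 j + outlen I j > t} p0 ws0 = (p, ws)"
    by simp
  obtain pre where pre: "ord = pre @ ws0" "sorted (map p0 pre)" using Suc.IH[OF e] by blast
  obtain us where us: "ws0 = us @ ws" using admit_prefix[OF a] by blast
  have d: "distinct (pre @ us @ ws)" using assms(1) pre us by simp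
  have s: "\<And>j. j \<notin> set ws0 \<Longrightarrow> p j = p0 j" "\<And>j. j \<in> set us \<Longrightarrow> p j = t"
    using admit_started[OF a] d us by auto
  have lt: "\<And>j. j \<in> set pre \<Longrightarrow> p0 j < t" using exec_started[OF assms(1) e] pre d us by auto
  have "map p pre = map p0 pre" using s(1) d us by auto
  then have "sorted (map p pre)" using pre(2) by metis
  moreover have "sorted (map p us)" using s(2) by (auto simp: sorted_iff_nth_mono)
  moreover have "p x \<le> p y" if "x \<in> set pre" "y \<in> set us" for x y
    using that s(1)[of x] s(2)[of y] lt[of x] d us by fastforce
  ultimately have "sorted (map p (pre @ us))"
    by (auto simp: sorted_append)
  then show ?case using pre us by auto
qed

lemma exec_keeps_starts:
  assumes "distinct ord" "exec M I ord t = (p, ws)" "exec M I ord (t + d) = (p', ws')"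
  shows "set ws' \<subseteq> set ws \<and> (\<forall>j. j \<notin> set ws \<longrightarrow> p' j = p j)"
  using assms(3)
proof (induction d arbitrary: p' ws')
  case 0
  then show ?case using assms(2) by simp
next
  case (Suc d)
  obtain p0 ws0 where e: "exec M I ord (t + d) = (p0, ws0)" by fastforce
  with Suc.prems have a:
    "admit M I (t + d) {j \<in> set ord - set ws0. p0 j + outlen I j > t + d} p0 ws0 = (p', ws')"
    by simp
  have "distinct ws0" using exec_started[OF assms(1) e] by blast
  from admit_started[OF a this] Suc.IH[OF e] show ?case by (metis subset_iff)
qed

lemma exists_minimum_of_both:
  fixes f g :: "'a \<Rightarrow> nat"
  assumes "sorted (map f ys)" "sorted (map g ys)" "A \<subseteq> set ys" "A \<noteq> {}"
  shows "\<exists>a\<in>A. \<forall>i\<in>A. f a \<le> f i \<and> g a \<le> g i"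
  using assms
proof (induction ys arbitrary: A)
  case Nil
  then show ?case by simp
next
  case (Cons y ys)
  show ?case
  proof (cases "y \<in> A")
    case True
    then show ?thesis using Cons.prems by (intro bexI[of _ y]) auto
  next
    case False
    then show ?thesis using Cons.prems by (intro Cons.IH) auto
  qed
qed

text \<open>
  Among the requests alive at time \<open>\<theta>\<close>, the first one in the order, \<open>a\<close>, is both the
  shortest and the longest running one.  So the memory in use is at most what the requests of
  length at least that of \<open>a\<close> occupy when they all have run for as long as \<open>a\<close> runs in total, which
  is one of the moments at which the feasibility of the batch is checked.
\<close>

lemma staggered_batch_fits:
  assumes cand: "batch_candidate M I R X" and fin: "finite X"
    and ys: "set ys \<subseteq> X" "sorted (map (outlen I) ys)" "sorted (map p ys)"
    and W: "W \<subseteq> set ys"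
  shows "mem_at I p W \<theta> \<le> M"
proof -
  let ?A = "{i \<in> W. \<theta> - p i \<le> outlen I i}"
  show ?thesis
  proof (cases "?A = {}")
    case True
    show ?thesis unfolding mem_at_def True by simp
  next
    case False
    obtain a where a: "a \<in> ?A" "\<And>i. i \<in> ?A \<Longrightarrow> outlen I a \<le> outlen I i \<and> p a \<le> p i"
      using exists_minimum_of_both[OF ys(2,3) _ False] W by blast
    have aX: "a \<in> X" using a(1) W ys(1) by blast
    have "mem_at I p W \<theta> \<le> mem_at I (\<lambda>_. 0) X (outlen I a)"
      unfolding mem_at_def
    proof (rule order.trans[OF sum_mono sum_mono2])
      fix i assume i: "i \<in> ?A"
      have "\<theta> - p i \<le> \<theta> - p a" using a(2)[OF i] by (simp add: diff_le_mono2)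
      also have "\<dots> \<le> outlen I a" using a(1) by simp
      finally show "prefill I i + (\<theta> - p i) \<le> prefill I i + (outlen I a - 0)" by simp
    next
      show "finite {i \<in> X. outlen I a - 0 \<le> outlen I i}" using fin by simp
      show "?A \<subseteq> {i \<in> X. outlen I a - 0 \<le> outlen I i}" using a(2) W ys(1) by auto
    qed simp
    also have "\<dots> \<le> M" using cand aX by (simp add: batch_candidate_def)
    finally show ?thesis .
  qed
qed

text \<open>
  Once everything before a batch has finished, a single scan starts all that is left of the batch:
  here \<open>ds\<close> is the part of the batch that has already been started.
\<close>

lemma admit_rest_of_batch:
  assumes cand: "batch_candidate M I R (set (ds @ zs))"
    and "sorted (map (outlen I) (ds @ zs))" "distinct (ds @ zs)"
    and "sorted (map p ds)" "\<And>j. j \<in> set ds \<Longrightarrow> p j \<le> t"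
    and "A = {j \<in> set ds. p j + outlen I j > t}"
    and "\<And>j. j \<in> set zs \<Longrightarrow> outlen I j > 0"
    and "admit M I t A p (zs @ post) = (p', ws')" "distinct (zs @ post)"
  shows "set ws' \<subseteq> set post"
  using assms
proof (induction zs arbitrary: ds A p)
  case Nil
  then show ?case using admit_started[of M I t A p post p' ws'] by auto
next
  case (Cons z zs)
  let ?p = "p(z := t)" and ?W = "insert z A" and ?ds = "ds @ [z]"
  have z: "z \<notin> set ds" using Cons.prems(3) by auto
  then have mp: "map ?p ds = map p ds" by auto
  have sp: "sorted (map ?p ?ds)"
    using Cons.prems(4,5) z mp by (auto simp: sorted_append simp del: fun_upd_apply)
       (simp_all add: fun_upd_def)
  have so: "sorted (map (outlen I) ?ds)"
    using Cons.prems(2) by (auto simp: sorted_append)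
  have chk: "\<forall>j\<in>?W. mem_at I ?p ?W (?p j + outlen I j) \<le> M"
    by (intro ballI staggered_batch_fits[OF Cons.prems(1) _ _ so sp])
       (use Cons.prems(6) in auto)
  have adm: "admit M I t ?W ?p (zs @ post) = (p', ws')"
    using Cons.prems(8) unfolding append_Cons admit_yes[OF chk] .
  have A: "?W = {j \<in> set ?ds. ?p j + outlen I j > t}"
    using Cons.prems(6) Cons.prems(7)[of z] z by auto
  have le: "?p j \<le> t" if "j \<in> set ?ds" for j
    using that Cons.prems(5) by auto
  show ?case
    by (rule Cons.IH[OF _ _ _ sp le A _ adm]) (use Cons.prems in auto)
qed

text \<open>A run of the batch construction, with the boundaries of the batches kept.\<close>

primrec greedy_batches :: "nat \<Rightarrow> requests \<Rightarrow> nat set \<Rightarrow> nat list list \<Rightarrow> bool" where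
  "greedy_batches M I R [] \<longleftrightarrow> R = {}"
| "greedy_batches M I R (xs # Bs) \<longleftrightarrow>
     best_batch M I R (set xs) \<and> distinct xs \<and> sorted (map (outlen I) xs) \<and>
     greedy_batches M I (R - set xs) Bs"

primrec serial_start :: "requests \<Rightarrow> nat \<Rightarrow> nat list list \<Rightarrow> nat \<Rightarrow> nat" where
  "serial_start I t [] i = t"
| "serial_start I t (xs # Bs) i =
     (if i \<in> set xs then t else serial_start I (t + Max (outlen I ` set xs)) Bs i)"

lemma batch_order_greedy_batches:
  assumes "batch_order M I R ord"
  shows "\<exists>Bs. ord = concat Bs \<and> greedy_batches M I R Bs"
  using assms
proof induction
  case empty
  then show ?case by (intro exI[of _ "[]"]) simp
next
  case (batch R X xs ys)
  then obtain Bs where "ys = concat Bs" "greedy_batches M I (R - X) Bs" by blast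
  then show ?case using batch by (intro exI[of _ "xs # Bs"]) auto
qed

text \<open>
  The induction runs over the batches still to come.  Its hypothesis at time \<open>t\<close> is that
  all requests of the earlier batches \<open>pre\<close> have finished by \<open>t\<close>, so that only a part of the
  current batch can be running, and possibly parts of later ones.
\<close>

lemma exec_starts_by_serial_start:
  assumes gb: "greedy_batches M I R Bs"
    and ord: "ord = pre @ concat Bs" "distinct ord" "\<And>j. j \<in> set ord \<Longrightarrow> outlen I j > 0"
    and st: "exec M I ord t = (p, ws)" "set pre \<inter> set ws = {}"
      "\<And>j. j \<in> set pre \<Longrightarrow> p j + outlen I j \<le> t"
    and fin: "exec M I ord u = (q, [])"
    and i: "i \<in> set (concat Bs)"
  shows "q i \<le> serial_start I t Bs i"
  using gb ord(1) st i
proof (induction Bs arbitrary: R pre t p ws)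
  case Nil
  then show ?case by simp
next
  case (Cons xs Bs)
  let ?post = "concat Bs" and ?T = "Max (outlen I ` set xs)"
  have ordx: "ord = pre @ xs @ ?post" using Cons.prems(2) by simp
  have cand: "batch_candidate M I R (set xs)" and so: "sorted (map (outlen I) xs)"
    using Cons.prems(1) by (auto simp: best_batch_def)
  note es = exec_started[OF ord(2) Cons.prems(3)]
  obtain dn where dn: "ord = dn @ ws" "sorted (map p dn)"
    using exec_prefix_sorted[OF ord(2) Cons.prems(3)] by blast
  obtain p' ws' where e': "exec M I ord (Suc t) = (p', ws')" by fastforce
  then have a: "admit M I t {j \<in> set ord - set ws. p j + outlen I j > t} p ws = (p', ws')"
    using Cons.prems(3) by simp
  have sub: "set ws' \<subseteq> set ?post"
  proof (cases "set ws \<subseteq> set ?post")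
    case True
    then show ?thesis using admit_started[OF a] es by blast
  next
    case False
    \<comment> \<open>The waiting list then begins inside the current batch.\<close>
    have "pre @ (xs @ ?post) = dn @ ws" using ordx dn(1) by simp
    then obtain us where us: "pre = dn @ us \<and> us @ xs @ ?post = ws \<or> pre @ us = dn \<and> xs @ ?post = us @ ws"
      unfolding append_eq_append_conv2 by blast
    have "us = []" if "us @ xs @ ?post = ws" "pre = dn @ us"
      using that Cons.prems(4) by (cases us) auto
    then obtain ds where ds: "dn = pre @ ds" "xs @ ?post = ds @ ws"
      using us by (metis append_Nil append_Nil2)
    from ds(2) obtain zs where "xs = ds @ zs \<and> zs @ ?post = ws \<or> ?post = zs @ ws"
      unfolding append_eq_append_conv2 by blast
    moreover have "set ws \<subseteq> set ?post" if "?post = zs @ ws" unfolding that by simp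
    ultimately have zs: "xs = ds @ zs" "ws = zs @ ?post" using False by blast+
    have d: "distinct (pre @ ds @ zs @ ?post)" using ord(2) ordx zs by simp
    have A: "{j \<in> set ord - set ws. p j + outlen I j > t} = {j \<in> set ds. p j + outlen I j > t}"
      using d ordx zs by (auto dest: Cons.prems(5))
    show ?thesis
    proof (rule admit_rest_of_batch)
      show "batch_candidate M I R (set (ds @ zs))" using cand zs by simp
      show "admit M I t {j \<in> set ds. p j + outlen I j > t} p (zs @ ?post) = (p', ws')"
        using a unfolding A unfolding zs(2) .
      show "sorted (map p ds)" using dn(2) ds(1) by (simp add: sorted_append)
      show "p j \<le> t" if "j \<in> set ds" for j
      proof -
        have "j \<in> set ord - set ws" using that d ordx zs by auto
        then show ?thesis using es by (auto intro: less_imp_le)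
      qed
      show "outlen I j > 0" if "j \<in> set zs" for j using that ord(3) ordx zs by auto
    qed (use so d zs in auto)
  qed
  have dist: "distinct (pre @ xs @ ?post)" using ord(2) ordx by simp
  have p'le: "p' j \<le> t" if "j \<in> set (pre @ xs)" for j
  proof -
    have "j \<in> set ord - set ws'" using that sub ordx dist by auto
    then show ?thesis using exec_started[OF ord(2) e'] by (auto simp: less_Suc_eq_le)
  qed
  show ?case
  proof (cases "i \<in> set xs")
    case True
    have "q i \<le> t"
    proof (cases "Suc t \<le> u")
      case True
      then obtain d where "u = Suc t + d" using le_Suc_ex by blast
      then have "q i = p' i"
        using exec_keeps_starts[OF ord(2) e', of d q "[]"] fin sub \<open>i \<in> set xs\<close> dist by auto
      then show ?thesis using p'le \<open>i \<in> set xs\<close> by simp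
    next
      case False
      have "q i < u" using exec_started[OF ord(2) fin] \<open>i \<in> set xs\<close> ordx by auto
      then show ?thesis using False by simp
    qed
    then show ?thesis using True by simp
  next
    case False
    have "set xs \<noteq> {}" using cand by (simp add: batch_candidate_def)
    then obtain x where x: "x \<in> set xs" by (meson ex_in_conv)
    have "outlen I x \<le> ?T" using x by simp
    moreover have "outlen I x > 0" using x ord(3) ordx by simp
    \<comment> \<open>The state before the scan at \<open>t + ?T\<close> has to include the effect of the scan at \<open>t\<close>.\<close>
    ultimately obtain d where d: "t + ?T = Suc t + d"
      using le_Suc_ex[of "Suc t" "t + ?T"] by auto
    obtain p2 ws2 where e2: "exec M I ord (t + ?T) = (p2, ws2)" by fastforce
    have k: "set ws2 \<subseteq> set ws'" "\<And>j. j \<notin> set ws' \<Longrightarrow> p2 j = p' j"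
      using exec_keeps_starts[OF ord(2) e', of d p2 ws2] e2 d by auto
    have done': "p2 j + outlen I j \<le> t + ?T" if j: "j \<in> set (pre @ xs)" for j
    proof (cases "j \<in> set xs")
      case True
      have "p2 j = p' j" using k(2) sub dist True by auto
      moreover have "outlen I j \<le> ?T" using True by simp
      ultimately show ?thesis using p'le[OF j] by simp
    next
      case False
      then have jp: "j \<in> set pre" using j by simp
      then have "j \<notin> set ws" using Cons.prems(4) by blast
      then have "p2 j = p j"
        using exec_keeps_starts[OF ord(2) Cons.prems(3) e2] by blast
      then show ?thesis using Cons.prems(5)[OF jp] by simp
    qed
    have "set (pre @ xs) \<inter> set ?post = {}" using dist by auto
    then have disj: "set (pre @ xs) \<inter> set ws2 = {}" using k(1) sub by blast
    have "q i \<le> serial_start I (t + ?T) Bs i"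
      by (rule Cons.IH[OF _ _ e2 disj done'])
         (use Cons.prems(1,6) False ordx in auto)
    then show ?thesis using False by simp
  qed
qed

section \<open>Prices\<close>

lemma batch_candidate_subset:
  assumes "batch_candidate M I R X" "finite X" "Y \<subseteq> X" "Y \<noteq> {}"
  shows "batch_candidate M I R Y"
proof -
  have "mem_at I (\<lambda>_. 0) Y t \<le> mem_at I (\<lambda>_. 0) X t" for t
    unfolding mem_at_def by (rule sum_mono2) (use assms in auto)
  then show ?thesis using assms unfolding batch_candidate_def by (meson dual_order.trans subset_iff)
qed

text \<open>
  Otherwise the batch would have at least two requests, and without its longest one it would
  have a smaller value of \<open>F\<close>.
\<close>

lemma best_batch_longest:
  assumes bb: "best_batch M I R X" and fin: "finite X"
  shows "real (Max (outlen I ` X)) \<le> 2 * real (card X) * F_val I X"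
proof -
  have cand: "batch_candidate M I R X" and ne: "X \<noteq> {}"
    using bb by (auto simp: best_batch_def batch_candidate_def)
  have "Max (outlen I ` X) \<in> outlen I ` X" using fin ne by simp
  then obtain x where x: "x \<in> X" "Max (outlen I ` X) = outlen I x" by auto
  define m where "m = real (card X)"
  define O' where "O' = (\<Sum>i\<in>X. real (outlen I i))"
  define T where "T = real (outlen I x)"
  have m: "m \<ge> 1" using fin ne by (simp add: m_def Suc_leI card_gt_0_iff)
  have rest: "(\<Sum>i\<in>X - {x}. real (outlen I i)) = O' - T"
    using fin x by (simp add: O'_def T_def sum_diff1)
  have nonneg: "0 \<le> O' - T" unfolding rest[symmetric] by (rule sum_nonneg) simp
  have T0: "T \<ge> 0" by (simp add: T_def)
  have "T * m \<le> 2 * O'"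
  proof (cases "X = {x}")
    case True
    then show ?thesis by (simp add: T_def m_def O'_def)
  next
    case False
    let ?Y = "X - {x}"
    have Yne: "?Y \<noteq> {}" using False x by auto
    have "F_val I X \<le> F_val I ?Y"
      using bb batch_candidate_subset[OF cand fin _ Yne] unfolding best_batch_def by fastforce
    moreover have cY: "real (card ?Y) = m - 1"
      using fin x m unfolding m_def by (simp add: card_Diff_singleton of_nat_diff Suc_leI card_gt_0_iff)
    ultimately have F: "O' / m\<^sup>2 \<le> (O' - T) / (m - 1)\<^sup>2"
      using rest by (simp add: F_val_def O'_def m_def)
    have m1: "m - 1 > 0" using cY fin Yne by (metis card_gt_0_iff finite_Diff of_nat_0_less_iff)
    from F have "O' * (m - 1)\<^sup>2 \<le> (O' - T) * m\<^sup>2"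
      using m m1 by (simp add: divide_simps split: if_splits)
    then have "T * m\<^sup>2 \<le> O' * (2 * m - 1)" by (simp add: power2_eq_square algebra_simps)
    also have "\<dots> \<le> O' * (2 * m)" using nonneg T0 by (intro mult_left_mono) auto
    finally have "m * (T * m) \<le> m * (2 * O')" by (simp add: power2_eq_square algebra_simps)
    then show ?thesis using m by simp
  qed
  then have "T \<le> 2 * O' / m" using m by (simp add: field_simps)
  also have "\<dots> = 2 * m * F_val I X"
    using m by (simp add: F_val_def O'_def m_def power2_eq_square)
  finally show ?thesis using x by (simp add: T_def m_def)
qed

primrec batch_price :: "requests \<Rightarrow> nat set \<Rightarrow> nat list list \<Rightarrow> nat \<Rightarrow> real" where
  "batch_price I R [] i = 0"
| "batch_price I R (xs # Bs) i =
     (if i \<in> set xs then F_val I (set xs) * real (card R) else batch_price I (R - set xs) Bs i)"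

lemma F_val_nonneg: "F_val I X \<ge> 0"
  by (simp add: F_val_def sum_nonneg)

text \<open>
  While the current batch of span \<open>T\<close> runs, each request in \<open>R\<close> waits or runs for at most \<open>T\<close>
  time units, so the batch contributes at most \<open>T * card R\<close> to the total latency.
\<close>

lemma serial_latency_le_price:
  assumes "greedy_batches M I R Bs" "finite R"
  shows "(\<Sum>i\<in>R. real (serial_start I t Bs i + outlen I i))
           \<le> real (card R) * real t + 2 * (\<Sum>i\<in>R. batch_price I R Bs i)"
  using assms
proof (induction Bs arbitrary: R t)
  case Nil
  then show ?case by simp
next
  case (Cons xs Bs)
  let ?X = "set xs" and ?R' = "R - set xs"
  let ?T = "Max (outlen I ` ?X)"
  have bb: "best_batch M I R ?X" and gb: "greedy_batches M I ?R' Bs" using Cons.prems(1) by auto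
  have sub: "?X \<subseteq> R" using bb by (auto simp: best_batch_def batch_candidate_def)
  have R: "R = ?X \<union> ?R'" using sub by auto
  have split: "(\<Sum>i\<in>R. f i) = (\<Sum>i\<in>?X. f i) + (\<Sum>i\<in>?R'. f i)" for f :: "nat \<Rightarrow> real"
    using sub Cons.prems(2) by (metis List.finite_set add.commute sum.subset_diff)
  have cR: "real (card R) = real (card ?X) + real (card ?R')"
    using split[of "\<lambda>_. 1"] by simp
  have "(\<Sum>i\<in>?X. real (serial_start I t (xs # Bs) i + outlen I i)) \<le> (\<Sum>i\<in>?X. real t + real ?T)"
    by (rule sum_mono) simp
  then have 1: "(\<Sum>i\<in>?X. real (serial_start I t (xs # Bs) i + outlen I i))
      \<le> real (card ?X) * (real t + real ?T)" by simp
  have "(\<Sum>i\<in>?R'. real (serial_start I t (xs # Bs) i + outlen I i))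
      = (\<Sum>i\<in>?R'. real (serial_start I (t + ?T) Bs i + outlen I i))"
    by (rule sum.cong) auto
  also have "\<dots> \<le> real (card ?R') * real (t + ?T) + 2 * (\<Sum>i\<in>?R'. batch_price I ?R' Bs i)"
    using Cons.IH[OF gb] Cons.prems(2) by blast
  also have "(\<Sum>i\<in>?R'. batch_price I ?R' Bs i) = (\<Sum>i\<in>?R'. batch_price I R (xs # Bs) i)"
    by (rule sum.cong) auto
  finally have 2: "(\<Sum>i\<in>?R'. real (serial_start I t (xs # Bs) i + outlen I i))
      \<le> real (card ?R') * (real t + real ?T) + 2 * (\<Sum>i\<in>?R'. batch_price I R (xs # Bs) i)" by simp
  have "real (card R) * real ?T \<le> real (card R) * (2 * real (card ?X) * F_val I ?X)"
    by (intro mult_left_mono best_batch_longest[OF bb]) auto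
  also have "\<dots> = 2 * (\<Sum>i\<in>?X. batch_price I R (xs # Bs) i)" by simp
  finally have 3: "real (card R) * real ?T \<le> 2 * (\<Sum>i\<in>?X. batch_price I R (xs # Bs) i)" .
  show ?case using 1 2 3 unfolding split[of "\<lambda>i. real (serial_start I t (xs # Bs) i + outlen I i)"]
      split[of "\<lambda>i. batch_price I R (xs # Bs) i"] cR by (simp add: algebra_simps)
qed

section \<open>Completions in an arbitrary schedule\<close>

lemma filling_initial_segment:
  fixes w :: "'a \<Rightarrow> real" and v :: "'a \<Rightarrow> nat"
  assumes "finite S" "(\<Sum>i\<in>S. w i) > c" "c \<ge> 0" "\<And>i. i \<in> S \<Longrightarrow> w i \<le> b"
  shows "\<exists>G\<subseteq>S. (\<Sum>i\<in>G. w i) \<le> c \<and> (\<Sum>i\<in>G. w i) > c - b \<and> (\<forall>x\<in>G. \<forall>y\<in>S - G. v x \<le> v y)"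
  using assms(1,2,4)
proof (induction S rule: finite_ranking_induct[where f = v])
  case empty
  then show ?case using assms(3) by simp
next
  case (insert x S)
  show ?case
  proof (cases "x \<in> S")
    case True
    then show ?thesis using insert by (simp add: insert_absorb)
  next
    case x: False
    show ?thesis
    proof (cases "(\<Sum>i\<in>S. w i) \<le> c")
      case True
      have "w x \<le> b" using insert.prems(2) by simp
      then have "(\<Sum>i\<in>S. w i) > c - b" using insert.prems(1) insert.hyps(1) x by simp
      then show ?thesis using True insert.hyps(2) by (intro exI[of _ S]) auto
    next
      case False
      then obtain G where G: "G \<subseteq> S" "(\<Sum>i\<in>G. w i) \<le> c" "(\<Sum>i\<in>G. w i) > c - b"
        "\<forall>x\<in>G. \<forall>y\<in>S - G. v x \<le> v y"
        using insert.IH insert.prems(2) by (auto simp: not_le)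
      have "\<forall>y\<in>G. \<forall>z\<in>insert x S - G. v y \<le> v z"
        using G(1,4) insert.hyps(2) by (metis Diff_iff insertE subsetD)
      then show ?thesis using G by (intro exI[of _ G]) auto
    qed
  qed
qed

text \<open>
  A group \<open>G\<close> that fills the memory up to \<open>b\<close> has weighted length
  at least \<open>a * (c - b)\<close>, where \<open>a\<close> is a lower bound for its lengths; and its average length, at
  least \<open>f * card G\<close>, is a lower bound for the lengths in the rest.  The term
  \<open>a * (c - b)\<close> on the left-hand side, which the induction passes from a group to the next one,
  links the two facts.  The allowance \<open>2 * \<tau>\<close> covers the last two groups, for which there
  is no next group that is known to be full.
\<close>

lemma grouping_bound:
  fixes w :: "'a \<Rightarrow> real" and v :: "'a \<Rightarrow> nat"
  assumes "finite S" "S \<noteq> {}" "0 \<le> b" "b < c"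
    and "\<And>i. i \<in> S \<Longrightarrow> 0 \<le> w i \<and> w i \<le> b"
    and "\<And>i. i \<in> S \<Longrightarrow> a \<le> real (v i) \<and> real (v i) \<le> \<tau>"
    and "\<And>Y. Y \<subseteq> S \<Longrightarrow> Y \<noteq> {} \<Longrightarrow> (\<Sum>i\<in>Y. w i) \<le> c \<Longrightarrow>
           f * (real (card Y))\<^sup>2 \<le> (\<Sum>i\<in>Y. real (v i))"
  shows "f * real (card S) * (c - b) + a * (c - b) \<le> (\<Sum>i\<in>S. real (v i) * w i) + 2 * \<tau> * (c - b)"
  using assms
proof (induction "card S" arbitrary: S a rule: less_induct)
  case less
  have avg: "f * real (card Y) \<le> d"
    if Y: "Y \<subseteq> S" "Y \<noteq> {}" "(\<Sum>i\<in>Y. w i) \<le> c" and d: "\<And>i. i \<in> Y \<Longrightarrow> real (v i) \<le> d" for Y d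
  proof -
    have "finite Y" using Y(1) less.prems(1) finite_subset by blast
    then have pos: "real (card Y) > 0" using Y(2) by (simp add: card_gt_0_iff)
    have "f * (real (card Y))\<^sup>2 \<le> (\<Sum>i\<in>Y. real (v i))" by (rule less.prems(7)[OF Y])
    also have "\<dots> \<le> real (card Y) * d" using sum_bounded_above[of Y "\<lambda>i. real (v i)" d] d by simp
    finally have "real (card Y) * (f * real (card Y)) \<le> real (card Y) * d"
      by (simp add: power2_eq_square algebra_simps)
    then show ?thesis using pos by simp
  qed
  have cb: "c - b > 0" using less.prems(4) by simp
  show ?case
  proof (cases "(\<Sum>i\<in>S. w i) \<le> c")
    case True
    have "f * real (card S) \<le> \<tau>" by (rule avg[OF order.refl less.prems(2) True]) (use less.prems(6) in auto)
    moreover have "a \<le> \<tau>" using less.prems(2,6) by force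
    ultimately have "(f * real (card S) + a) * (c - b) \<le> 2 * \<tau> * (c - b)"
      using cb by (intro mult_right_mono) auto
    moreover have "0 \<le> (\<Sum>i\<in>S. real (v i) * w i)" by (rule sum_nonneg) (use less.prems(5) in auto)
    ultimately show ?thesis by (simp add: algebra_simps)
  next
    case False
    then obtain G where G: "G \<subseteq> S" "(\<Sum>i\<in>G. w i) \<le> c" "(\<Sum>i\<in>G. w i) > c - b"
        "\<forall>x\<in>G. \<forall>y\<in>S - G. v x \<le> v y"
      using filling_initial_segment[OF less.prems(1), of c w b v] less.prems(3-5) by auto
    let ?S' = "S - G"
    have Gne: "G \<noteq> {}" using G(3) cb by auto
    have S'ne: "?S' \<noteq> {}" using G(1,2) False by auto
    have finG: "finite G" using G(1) less.prems(1) finite_subset by blast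
    define a' where "a' = Min (v ` ?S')"
    have "a' \<in> v ` ?S'" unfolding a'_def by (rule Min_in) (use less.prems(1) S'ne in auto)
    have a'le: "a' \<le> v i" if "i \<in> ?S'" for i
      unfolding a'_def by (rule Min_le) (use less.prems(1) that in auto)
    have Ga': "f * real (card G) \<le> real a'"
      by (rule avg[OF G(1) Gne G(2)]) (use G(4) \<open>a' \<in> v ` ?S'\<close> in auto)
    have "card ?S' < card S"
      by (rule psubset_card_mono) (use less.prems(1) G(1) Gne in auto)
    then have IH: "f * real (card ?S') * (c - b) + real a' * (c - b)
        \<le> (\<Sum>i\<in>?S'. real (v i) * w i) + 2 * \<tau> * (c - b)"
    proof (rule less.hyps)
      show "f * (real (card Y))\<^sup>2 \<le> (\<Sum>i\<in>Y. real (v i))"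
        if "Y \<subseteq> ?S'" "Y \<noteq> {}" "(\<Sum>i\<in>Y. w i) \<le> c" for Y
        using that by (intro less.prems(7)) auto
    qed (use less.prems(1,3-6) S'ne a'le in auto)
    have "a * (c - b) \<le> (\<Sum>i\<in>G. real (v i) * w i)"
    proof (cases "a \<ge> 0")
      case True
      have "a * (c - b) \<le> a * (\<Sum>i\<in>G. w i)" using G(3) True by (intro mult_left_mono) auto
      also have "\<dots> = (\<Sum>i\<in>G. a * w i)" by (simp add: sum_distrib_left)
      also have "\<dots> \<le> (\<Sum>i\<in>G. real (v i) * w i)"
        by (intro sum_mono mult_right_mono) (use less.prems(5,6) G(1) in auto)
      finally show ?thesis .
    next
      case False
      then have "a * (c - b) \<le> 0" using cb by (simp add: mult_nonpos_nonneg)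
      also have "0 \<le> (\<Sum>i\<in>G. real (v i) * w i)" by (rule sum_nonneg) (use less.prems(5) G(1) in auto)
      finally show ?thesis .
    qed
    moreover have "f * real (card G) * (c - b) \<le> real a' * (c - b)"
      using Ga' cb by (intro mult_right_mono) auto
    moreover have "(\<Sum>i\<in>S. real (v i) * w i) = (\<Sum>i\<in>?S'. real (v i) * w i) + (\<Sum>i\<in>G. real (v i) * w i)"
      using G(1) less.prems(1) by (rule sum.subset_diff)
    moreover have "real (card S) = real (card ?S') + real (card G)"
      using card_Diff_subset[OF finG G(1)] card_mono[OF less.prems(1) G(1)] by simp
    ultimately show ?thesis using IH by (simp add: algebra_simps)
  qed
qed

text \<open>
  The volume of a request is \<open>o * s + o * (o + 1) / 2\<close>, which is at least half the product of its
  length \<open>o\<close> and its peak memory \<open>s + o\<close>.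
\<close>

lemma volume_bound:
  assumes feas: "feasible M I p" and S: "S \<subseteq> {..<length I}" "\<And>i. i \<in> S \<Longrightarrow> p i + outlen I i \<le> t"
  shows "(\<Sum>i\<in>S. real (outlen I i) * real (prefill I i + outlen I i)) \<le> 2 * real M * real t"
proof -
  have finS: "finite S" using S(1) finite_subset by blast
  define g where "g i \<theta> = (if p i + 1 \<le> \<theta> \<and> \<theta> \<le> p i + outlen I i then prefill I i + (\<theta> - p i) else 0)"
    for i \<theta>
  have row: "outlen I i * (prefill I i + outlen I i) \<le> 2 * (\<Sum>\<theta>\<in>{1..t}. g i \<theta>)" if i: "i \<in> S" for i
  proof -
    have "(\<Sum>\<theta>\<in>{1..t}. g i \<theta>) = (\<Sum>\<theta>\<in>{p i + 1..p i + outlen I i}. g i \<theta>)"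
      by (rule sum.mono_neutral_right) (use S(2)[OF i] in \<open>auto simp: g_def\<close>)
    also have "\<dots> = (\<Sum>j\<in>{1..outlen I i}. prefill I i + j)"
      by (rule sum.reindex_bij_witness[of _ "\<lambda>j. p i + j" "\<lambda>\<theta>. \<theta> - p i"]) (auto simp: g_def)
    finally have eq: "(\<Sum>\<theta>\<in>{1..t}. g i \<theta>) = (\<Sum>j\<in>{1..outlen I i}. prefill I i + j)" .
    have "k * (s + k) \<le> 2 * (\<Sum>j\<in>{1..k}. s + j)" for s k :: nat
      by (induction k) (auto simp: algebra_simps)
    then show ?thesis unfolding eq .
  qed
  have col: "(\<Sum>i\<in>S. g i \<theta>) \<le> M" if \<theta>: "\<theta> \<in> {1..t}" for \<theta>
  proof -
    have "(\<Sum>i\<in>S. g i \<theta>) \<le> (\<Sum>i<length I. g i \<theta>)" by (rule sum_mono2) (use S(1) in auto)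
    also have "\<dots> = (\<Sum>i | i < length I \<and> p i + 1 \<le> \<theta> \<and> \<theta> \<le> p i + outlen I i. prefill I i + (\<theta> - p i))"
      unfolding g_def by (rule sum.mono_neutral_cong_right) auto
    also have "\<dots> \<le> M" using feas \<theta> by (simp add: feasible_def)
    finally show ?thesis .
  qed
  have "(\<Sum>i\<in>S. outlen I i * (prefill I i + outlen I i)) \<le> (\<Sum>i\<in>S. 2 * (\<Sum>\<theta>\<in>{1..t}. g i \<theta>))"
    by (rule sum_mono) (rule row)
  also have "\<dots> = 2 * (\<Sum>\<theta>\<in>{1..t}. \<Sum>i\<in>S. g i \<theta>)"
    by (simp add: sum_distrib_left[symmetric] sum.swap[of _ _ S])
  also have "\<dots> \<le> 2 * (\<Sum>\<theta>\<in>{1..t}. M)" by (intro mult_left_mono sum_mono col) auto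
  also have "\<dots> = 2 * M * t" by simp
  finally have "real (\<Sum>i\<in>S. outlen I i * (prefill I i + outlen I i)) \<le> real (2 * M * t)"
    by (simp only: of_nat_le_iff)
  then show ?thesis by simp
qed

lemma completions_bound:
  assumes feas: "feasible M I p"
    and small: "\<And>i. i < length I \<Longrightarrow> 5 * (prefill I i + outlen I i) \<le> M" and M: "M > 0"
    and S: "S \<subseteq> R" "R \<subseteq> {..<length I}" "\<And>i. i \<in> S \<Longrightarrow> p i + outlen I i \<le> t"
    and f: "\<And>Y. batch_candidate M I R Y \<Longrightarrow> f \<le> F_val I Y"
  shows "f * real (card S) \<le> 9/2 * real t"
proof (cases "S = {}")
  case True
  then show ?thesis by simp
next
  case False
  let ?w = "\<lambda>i. real (prefill I i + outlen I i)"
  have finS: "finite S" using S(1,2) by (meson finite_lessThan finite_subset)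
  have Sn: "S \<subseteq> {..<length I}" using S by blast
  have fits: "f * (real (card Y))\<^sup>2 \<le> (\<Sum>i\<in>Y. real (outlen I i))"
    if Y: "Y \<subseteq> S" "Y \<noteq> {}" "(\<Sum>i\<in>Y. ?w i) \<le> real M" for Y
  proof -
    have finY: "finite Y" using Y(1) finS finite_subset by blast
    have "real (\<Sum>i\<in>Y. prefill I i + outlen I i) \<le> real M" using Y(3) by simp
    then have wM: "(\<Sum>i\<in>Y. prefill I i + outlen I i) \<le> M" by (simp only: of_nat_le_iff)
    have "mem_at I (\<lambda>_. 0) Y \<theta> \<le> (\<Sum>i\<in>Y. prefill I i + outlen I i)" for \<theta>
      unfolding mem_at_def
      by (rule order.trans[OF sum_mono sum_mono2[of Y]]) (use finY in auto)
    then have "batch_candidate M I R Y"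
      using Y(1,2) S(1) wM unfolding batch_candidate_def by (meson order.trans)
    from f[OF this] show ?thesis
      using finY Y(2) by (simp add: F_val_def field_simps card_gt_0_iff)
  qed
  have sm: "?w i \<le> real M / 5" if "i \<in> S" for i
  proof -
    have "real (5 * (prefill I i + outlen I i)) \<le> real M"
      using small[of i] that Sn by (intro of_nat_mono) auto
    then show ?thesis by simp
  qed
  have "f * real (card S) * (real M - real M / 5) + 0 * (real M - real M / 5)
      \<le> (\<Sum>i\<in>S. real (outlen I i) * ?w i) + 2 * real t * (real M - real M / 5)"
  proof (rule grouping_bound[OF finS False])
    show "0 \<le> real (outlen I i) \<and> real (outlen I i) \<le> real t" if "i \<in> S" for i
      using S(3)[OF that] by simp
  qed (use sm M fits in auto)
  also have "(\<Sum>i\<in>S. real (outlen I i) * ?w i) \<le> 2 * real M * real t"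
    using volume_bound[OF feas Sn S(3)] by simp
  finally have "real M * (f * real (card S)) \<le> real M * (9/2 * real t)" by (simp add: algebra_simps)
  then show ?thesis using M by simp
qed

section \<open>Comparison with the optimal schedule\<close>

text \<open>
  Consider the first batch whose price exceeds \<open>9 * t\<close>.  Requests with price above \<open>9 * t\<close> can only
  be among the requests remaining at that batch, and fewer than half of these complete by time \<open>t\<close>.
\<close>

lemma expensive_requests_complete_late:
  assumes "greedy_batches M I R Bs" "R \<subseteq> {..<length I}"
    and feas: "feasible M I p"
    and small: "\<And>i. i < length I \<Longrightarrow> 5 * (prefill I i + outlen I i) \<le> M" and M: "M > 0"
  shows "card {i\<in>R. 9 * real t < batch_price I R Bs i} \<le> 2 * card {i\<in>R. t < p i + outlen I i}"
  using assms(1,2)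
proof (induction Bs arbitrary: R)
  case Nil
  then show ?case by simp
next
  case (Cons xs Bs)
  let ?f = "F_val I (set xs)"
  have finR: "finite R" using Cons.prems(2) finite_subset by blast
  have bb: "best_batch M I R (set xs)" using Cons.prems(1) by simp
  show ?case
  proof (cases "9 * real t < ?f * real (card R)")
    case True
    let ?early = "{i\<in>R. p i + outlen I i \<le> t}" and ?late = "{i\<in>R. t < p i + outlen I i}"
    have "?f * real (card ?early) \<le> 9/2 * real t"
      by (rule completions_bound[OF feas small M _ Cons.prems(2)])
         (use bb in \<open>auto simp: best_batch_def\<close>)
    then have lt: "?f * (2 * real (card ?early)) < ?f * real (card R)" using True by simp
    have "2 * real (card ?early) < real (card R)"
      using mult_less_cancel_left[THEN iffD1, OF lt] F_val_nonneg[of I "set xs"] by auto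
    moreover have "card R = card ?early + card ?late"
      using finR by (subst card_Un_disjoint[symmetric]) (auto intro: arg_cong[where f = card])
    moreover have "card {i\<in>R. 9 * real t < batch_price I R (xs # Bs) i} \<le> card R"
      using finR by (intro card_mono) auto
    ultimately show ?thesis by linarith
  next
    case False
    let ?R' = "R - set xs"
    have "{i\<in>R. 9 * real t < batch_price I R (xs # Bs) i}
        = {i\<in>?R'. 9 * real t < batch_price I ?R' Bs i}" using False by auto
    moreover have "card {i\<in>?R'. 9 * real t < batch_price I ?R' Bs i}
        \<le> 2 * card {i\<in>?R'. t < p i + outlen I i}"
      using Cons.prems by (intro Cons.IH) auto
    moreover have "card {i\<in>?R'. t < p i + outlen I i} \<le> card {i\<in>R. t < p i + outlen I i}"
      using finR by (intro card_mono) auto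
    ultimately show ?thesis by simp
  qed
qed

text \<open>
  Integer thresholds suffice: the number of natural numbers below \<open>x i\<close> is \<open>x i\<close> rounded up, and
  the number of those below \<open>y i\<close> is exactly \<open>y i\<close>.
\<close>

lemma sum_le_of_level_sets:
  fixes x :: "'a \<Rightarrow> real" and y :: "'a \<Rightarrow> nat"
  assumes fin: "finite A"
    and lev: "\<And>t::nat. card {i\<in>A. real t < x i} \<le> 2 * card {i\<in>A. t < y i}"
  shows "(\<Sum>i\<in>A. x i) \<le> 2 * real (\<Sum>i\<in>A. y i)"
proof -
  obtain N :: nat where N: "\<And>i. i \<in> A \<Longrightarrow> x i \<le> real N \<and> y i \<le> N"
  proof -
    obtain N1 where "\<forall>z\<in>(\<lambda>i. nat \<lceil>x i\<rceil>) ` A \<union> y ` A. z \<le> N1"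
      using finite_nat_set_iff_bounded_le[of "(\<lambda>i. nat \<lceil>x i\<rceil>) ` A \<union> y ` A"] fin by blast
    then have le: "nat \<lceil>x i\<rceil> \<le> N1" "y i \<le> N1" if "i \<in> A" for i using that by blast+
    have "x i \<le> real N1 \<and> y i \<le> N1" if "i \<in> A" for i
      using le[OF that] by (meson of_nat_mono order.trans real_nat_ceiling_ge)
    then show thesis by (rule that)
  qed
  have swap: "(\<Sum>i\<in>A. card {t. t < N \<and> P t i}) = (\<Sum>t<N. card {i\<in>A. P t i})" for P
  proof -
    have "(\<Sum>i\<in>A. card {t. t < N \<and> P t i}) = (\<Sum>i\<in>A. \<Sum>t<N. if P t i then 1 else 0)"
      by (intro sum.cong refl) (simp add: sum.inter_filter[symmetric] Int_def flip: card_eq_sum)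
    also have "\<dots> = (\<Sum>t<N. \<Sum>i\<in>A. if P t i then 1 else 0)" by (rule sum.swap)
    also have "\<dots> = (\<Sum>t<N. card {i\<in>A. P t i})"
      by (intro sum.cong refl) (simp add: sum.inter_filter[symmetric] fin flip: card_eq_sum)
    finally show ?thesis .
  qed
  have "x i \<le> real (card {t. t < N \<and> real t < x i})" if "i \<in> A" for i
  proof -
    have "{t. t < N \<and> real t < x i} = {..<nat \<lceil>x i\<rceil>}"
      using N[OF that] by (auto simp: zless_nat_eq_int_zless less_ceiling_iff)
    then show ?thesis by (simp add: real_nat_ceiling_ge)
  qed
  then have "(\<Sum>i\<in>A. x i) \<le> real (\<Sum>i\<in>A. card {t. t < N \<and> real t < x i})"
    by (simp add: sum_mono)
  also have "\<dots> \<le> real (2 * (\<Sum>t<N. card {i\<in>A. t < y i}))"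
    unfolding swap sum_distrib_left by (intro of_nat_mono sum_mono lev)
  also have "(\<Sum>t<N. card {i\<in>A. t < y i}) = (\<Sum>i\<in>A. y i)"
  proof -
    have "{t. t < N \<and> t < y i} = {..<y i}" if "i \<in> A" for i using N[OF that] by auto
    then show ?thesis unfolding swap[symmetric] by simp
  qed
  finally show ?thesis by simp
qed

theorem SortedF_approximation:
  assumes val: "valid_instance I" and M: "M > 0"
    and small: "\<And>i. i < length I \<Longrightarrow> 5 * (prefill I i + outlen I i) \<le> M"
    and q: "q \<in> SortedF M I"
  shows "real (TEL I q) \<le> 36 * real (TEL_opt M I)"
proof -
  let ?R = "{..<length I}"
  have "\<And>i. i < length I \<Longrightarrow> prefill I i + outlen I i \<le> M" using small by fastforce
  then obtain p where p: "feasible M I p" "TEL I p = TEL_opt M I"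
    using TEL_opt_attained[OF _ val] by blast
  obtain ord u where o: "batch_order M I ?R ord" and e: "exec M I ord u = (q, [])"
    using q by (auto simp: SortedF_def)
  obtain Bs where Bs: "ord = concat Bs" "greedy_batches M I ?R Bs"
    using batch_order_greedy_batches[OF o] by blast
  note op = batch_order_props[OF o]
  have "q i \<le> serial_start I 0 Bs i" if "i < length I" for i
    by (rule exec_starts_by_serial_start[where ord = ord and pre = "[]", OF Bs(2) _ _ _ _ _ _ e])
       (use op that val Bs(1) in \<open>auto simp: valid_instance_def\<close>)
  then have "real (TEL I q) \<le> (\<Sum>i\<in>?R. real (serial_start I 0 Bs i + outlen I i))"
    unfolding TEL_def of_nat_sum by (intro sum_mono) simp
  also have "\<dots> \<le> 2 * (\<Sum>i\<in>?R. batch_price I ?R Bs i)"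
    using serial_latency_le_price[OF Bs(2), of 0] by simp
  also have "\<dots> = 18 * (\<Sum>i\<in>?R. batch_price I ?R Bs i / 9)"
    by (simp add: sum_divide_distrib[symmetric])
  also have "(\<Sum>i\<in>?R. batch_price I ?R Bs i / 9) \<le> 2 * real (\<Sum>i\<in>?R. p i + outlen I i)"
    by (rule sum_le_of_level_sets)
       (use expensive_requests_complete_late[OF Bs(2) order.refl p(1) small M]
         in \<open>auto simp: less_divide_eq mult.commute\<close>)
  finally show ?thesis unfolding p(2)[symmetric] TEL_def by simp
qed

theorem theorem3:
  fixes I :: "nat \<Rightarrow> requests"
  assumes "\<And>M. M > 0 \<Longrightarrow> valid_instance (I M)"
    and "(\<lambda>M. real (max_size (I M)) / real M) \<longlonglongrightarrow> 0"
    and "filterlim (\<lambda>M. real (length (I M)) * real (max_size (I M)) / real M) at_top sequentially"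
  shows "\<exists>M0. (SUP M\<in>{M0..}. SUP p\<in>SortedF M (I M).
            ereal (real (TEL (I M) p) / real (TEL_opt M (I M)))) < 48"
proof -
  have "eventually (\<lambda>M. real (max_size (I M)) / real M < 1/5 \<and> M > 0) sequentially"
    by (intro eventually_conj order_tendstoD(2)[OF assms(2)] eventually_gt_at_top) simp
  then obtain M0 where M0: "\<And>M. M \<ge> M0 \<Longrightarrow> real (max_size (I M)) / real M < 1/5 \<and> M > 0"
    by (auto simp: eventually_sequentially)
  have "real (TEL (I M) p) / real (TEL_opt M (I M)) \<le> 36"
    if M: "M \<ge> M0" and p: "p \<in> SortedF M (I M)" for M p
  proof -
    have pos: "M > 0" using M0[OF M] by simp
    have "5 * max_size (I M) \<le> M" using M0[OF M] pos by (auto simp: divide_less_eq)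
    moreover have "prefill (I M) i + outlen (I M) i \<le> max_size (I M)" if "i < length (I M)" for i
      unfolding max_size_def by (rule Max_ge) (use that in auto)
    ultimately have "5 * (prefill (I M) i + outlen (I M) i) \<le> M" if "i < length (I M)" for i
      using that by (meson mult_le_mono2 order.trans)
    from SortedF_approximation[OF assms(1)[OF pos] pos this p]
    show ?thesis by (cases "TEL_opt M (I M) = 0") (simp_all add: divide_simps)
  qed
  then have "(SUP M\<in>{M0..}. SUP p\<in>SortedF M (I M).
      ereal (real (TEL (I M) p) / real (TEL_opt M (I M)))) \<le> 36"
    by (intro SUP_least) simp
  also have "(36::ereal) < 48" by simp
  finally show ?thesis by blast
qed

end
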